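(* Let $n\geqslant 2$ and let $E\subset\mathbb{R}^n$ be an open weakly $1$-convex set whose $1$-nonconvexity-point set $E^{\triangle}$ is non-empty. Then there exists a collection of straight lines $\{\gamma(x)\}_{x\in\partial E^{\triangle}}$, where $\gamma(x)$ passes through $x$, such that: (i) the set $\bigcup_{x\in\partial E^{\triangle}}\gamma(x)\cup E^{\triangle}$ does not contain any straight line passing through a point of $E^{\triangle}$; and (ii) $\left(\bigcup_{x\in\partial E^{\triangle}}\gamma(x)\right)\cap E=\varnothing$.
   Context: $\mathbb{R}^n$ carries the Euclidean norm. An open set $E\subset\mathbb{R}^n$ is called weakly $1$-convex if for every point $x\in\partial E$ there exists a straight line $L$ (a $1$-dimensional affine subspace) with $x\in L$ and $L\cap E=\varnothing$. A point $x\in\mathbb{R}^n\setminus E$ is a $1$-nonconvexity point of $E\subset\mathbb{R}^n$ if every straight line passing through $x$ intersects $E$. $E^{\triangle}$ denotes the set of all $1$-nonconvexity points of $E$. *)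

theory Defs
  imports "HOL-Analysis.Analysis"
begin

definition straight_line :: "'a::euclidean_space set \<Rightarrow> bool" where
  "straight_line L \<longleftrightarrow> affine L \<and> aff_dim L = 1"

(* Intended for open sets E only; openness is assumed separately where it is used. *)
definition weakly_1_convex :: "'a::euclidean_space set \<Rightarrow> bool" where
  "weakly_1_convex E \<longleftrightarrow> (\<forall>x\<in>frontier E. \<exists>L. straight_line L \<and> x \<in> L \<and> L \<inter> E = {})"

definition nonconvexity_points_1 :: "'a::euclidean_space set \<Rightarrow> 'a set" where
  "nonconvexity_points_1 E =
     {x. x \<notin> E \<and> (\<forall>L. straight_line L \<and> x \<in> L \<longrightarrow> L \<inter> E \<noteq> {})}"

end

theory Submission
  imports Defs
begin

text \<open>The set \<open>E\<^sup>\<triangle>\<close> is disjoint from \<open>E\<close>, and every line through one of its points meets \<open>E\<close>, so (i)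
  follows from (ii) for any choice of lines. A suitable line exists at a boundary point of \<open>E\<^sup>\<triangle>\<close>
  because \<open>E\<^sup>\<triangle>\<close> is open: its complement is \<open>closure E\<close> (by weak 1-convexity) together with the
  points lying on a line that misses \<open>E\<close>, and the latter set is closed by compactness of the
  sphere of directions.\<close>

text \<open>Normalised directions let the lines through a point be indexed by the compact unit
  sphere, as the projection argument for closedness requires.\<close>

lemma straight_line_through_iff:
  fixes x :: "'a::euclidean_space"
  shows "straight_line L \<and> x \<in> L \<longleftrightarrow> (\<exists>u. norm u = 1 \<and> L = range (\<lambda>t. x + t *\<^sub>R u))"
proof
  assume L: "straight_line L \<and> x \<in> L"
  then have "affine L" "aff_dim L = 1" "x \<in> L"
    by (auto simp: straight_line_def)
  moreover have "L \<noteq> {x}"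
    using \<open>aff_dim L = 1\<close> by auto
  ultimately obtain y where y: "y \<in> L" "y \<noteq> x"
    by blast
  have "affine hull {x, y} = L"
  proof (rule affine_dim_equal)
    show "affine hull {x, y} \<subseteq> L"
      using \<open>affine L\<close> \<open>x \<in> L\<close> y by (intro hull_minimal) auto
    show "aff_dim (affine hull {x, y}) = aff_dim L"
      using \<open>aff_dim L = 1\<close> y by (simp add: aff_dim_2)
  qed (use \<open>affine L\<close> in auto)
  then have "L = range (\<lambda>t. x + t *\<^sub>R (y - x))"
    by (simp add: affine_hull_2_alt)
  \<comment> \<open>Normalising the direction only rescales the parameter by
    \<open>norm (y - x)\<close>, which is nonzero.\<close>
  also have "\<dots> = range (\<lambda>t. x + t *\<^sub>R sgn (y - x))"
  proof (intro equalityI subsetI)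
    fix z assume "z \<in> range (\<lambda>t. x + t *\<^sub>R (y - x))"
    then obtain t where "z = x + t *\<^sub>R (y - x)"
      by auto
    also have "\<dots> = x + (t * norm (y - x)) *\<^sub>R sgn (y - x)"
      using y by (simp add: sgn_div_norm)
    finally show "z \<in> range (\<lambda>t. x + t *\<^sub>R sgn (y - x))"
      by blast
  next
    fix z assume "z \<in> range (\<lambda>t. x + t *\<^sub>R sgn (y - x))"
    then obtain t where "z = x + t *\<^sub>R sgn (y - x)"
      by auto
    also have "\<dots> = x + (t / norm (y - x)) *\<^sub>R (y - x)"
      by (simp add: sgn_div_norm divide_inverse)
    finally show "z \<in> range (\<lambda>t. x + t *\<^sub>R (y - x))"
      by blast
  qed
  finally show "\<exists>u. norm u = 1 \<and> L = range (\<lambda>t. x + t *\<^sub>R u)"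
    using y by (intro exI[of _ "sgn (y - x)"]) (simp add: norm_sgn)
next
  assume "\<exists>u. norm u = 1 \<and> L = range (\<lambda>t. x + t *\<^sub>R u)"
  then obtain u where u: "norm u = 1" and L: "L = range (\<lambda>t. x + t *\<^sub>R u)"
    by blast
  have L': "L = affine hull {x, x + u}"
    by (simp add: L affine_hull_2_alt)
  have "x \<noteq> x + u"
    using u by auto
  then have "aff_dim L = 1"
    unfolding L' aff_dim_affine_hull aff_dim_2 by simp
  then show "straight_line L \<and> x \<in> L"
    by (simp add: L' straight_line_def hull_inc)
qed

lemma closed_points_on_missing_lines:
  fixes E :: "'a::euclidean_space set"
  assumes "open E"
  shows "closed {x. \<exists>L. straight_line L \<and> x \<in> L \<and> L \<inter> E = {}}"
proof -
  \<comment> \<open>Pairs (direction, base point) for which the whole parametrised line avoids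
    \<open>E\<close>; each fixed \<open>t\<close> contributes the preimage of a closed set under a
    continuous map.\<close>
  define T where "T = (\<Inter>t. (\<lambda>p::'a \<times> 'a. snd p + t *\<^sub>R fst p) -` (- E))"
  have "closed T"
    unfolding T_def using assms
    by (intro closed_INT ballI closed_vimage continuous_intros) auto
  then have "closed {x. \<exists>u. u \<in> sphere 0 1 \<and> (u, x) \<in> T}"
    \<comment> \<open>Projecting out \<open>u\<close> keeps closedness because \<open>u\<close>
      ranges over a compact set.\<close>
    by (intro closed_compact_projection) auto
  also have "{x. \<exists>u. u \<in> sphere 0 1 \<and> (u, x) \<in> T} =
      {x. \<exists>L. (straight_line L \<and> x \<in> L) \<and> L \<inter> E = {}}"
    unfolding straight_line_through_iff T_def by auto
  finally show ?thesis
    by (simp add: conj_assoc)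
qed

lemma open_nonconvexity_points_1:
  assumes "open E" "weakly_1_convex E"
  shows "open (nonconvexity_points_1 E)"
proof -
  \<comment> \<open>Taking \<open>closure E\<close> instead of \<open>E\<close> makes the first set
    closed and adds nothing new: by weak 1-convexity the frontier points already lie on a line
    missing \<open>E\<close>.\<close>
  have "- nonconvexity_points_1 E =
      closure E \<union> {x. \<exists>L. straight_line L \<and> x \<in> L \<and> L \<inter> E = {}}"
    using assms(2)
    unfolding nonconvexity_points_1_def weakly_1_convex_def closure_Un_frontier by auto
  then show ?thesis
    using closed_Un[OF closed_closure closed_points_on_missing_lines[OF assms(1)], of E]
    by (simp only: open_closed)
qed

theorem proposition2:
  fixes E :: "(real ^ 'n) set"
  assumes "CARD('n) \<ge> 2"
    and "open E"
    and "weakly_1_convex E"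
    and "nonconvexity_points_1 E \<noteq> {}"
  shows "\<exists>\<gamma> :: real ^ 'n \<Rightarrow> (real ^ 'n) set.
    (\<forall>x\<in>frontier (nonconvexity_points_1 E). straight_line (\<gamma> x) \<and> x \<in> \<gamma> x) \<and>
    (\<forall>p\<in>nonconvexity_points_1 E. \<forall>L. straight_line L \<and> p \<in> L \<longrightarrow>
       \<not> L \<subseteq> (\<Union>x\<in>frontier (nonconvexity_points_1 E). \<gamma> x) \<union> nonconvexity_points_1 E) \<and>
    (\<Union>x\<in>frontier (nonconvexity_points_1 E). \<gamma> x) \<inter> E = {}"
proof -
  let ?N = "nonconvexity_points_1 E"
  have disj: "E \<inter> ?N = {}"
    by (auto simp: nonconvexity_points_1_def)
  have "\<exists>L. straight_line L \<and> x \<in> L \<and> L \<inter> E = {}" if "x \<in> frontier ?N" for x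
  proof -
    \<comment> \<open>The open set \<open>?N\<close> excludes its own frontier, and the open set
      \<open>E\<close>, being disjoint from \<open>?N\<close>, misses \<open>closure ?N\<close>. A
      point outside both sets lies on a line missing \<open>E\<close>.\<close>
    have "x \<notin> ?N"
      using that open_nonconvexity_points_1[OF assms(2,3)] by (simp add: frontier_def interior_open)
    moreover have "x \<notin> E"
      using that open_Int_closure_eq_empty[OF assms(2), of ?N] disj by (auto simp: frontier_def)
    ultimately show ?thesis
      by (auto simp: nonconvexity_points_1_def)
  qed
  then obtain \<gamma> where \<gamma>: "\<And>x. x \<in> frontier ?N \<Longrightarrow> straight_line (\<gamma> x) \<and> x \<in> \<gamma> x \<and> \<gamma> x \<inter> E = {}"
    by metis
  then have miss: "(\<Union>x\<in>frontier ?N. \<gamma> x) \<inter> E = {}"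
    by blast
  have "\<not> L \<subseteq> (\<Union>x\<in>frontier ?N. \<gamma> x) \<union> ?N" if "p \<in> ?N" "straight_line L" "p \<in> L" for p L
  proof -
    have "L \<inter> E \<noteq> {}"
      using that unfolding nonconvexity_points_1_def by blast
    then show ?thesis
      using miss disj by blast
  qed
  with \<gamma> miss show ?thesis
    by blast
qed

end
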